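(* For every $n\ge1$ and every $k\ge1$, the bivariate statistics $(\mathrm{des}_k,\widetilde{\mathrm{maj}_k})$ and $(\widetilde{\mathrm{des}_{k+1}},\widetilde{\mathrm{maj}_{k+1}})$ have the same distribution over $\mathfrak{S}_n$; equivalently, $$\sum_{\sigma\in\mathfrak{S}_n}x^{\mathrm{des}_k(\sigma)}y^{\widetilde{\mathrm{maj}_k}(\sigma)}=\sum_{\sigma\in\mathfrak{S}_n}x^{\widetilde{\mathrm{des}_{k+1}}(\sigma)}y^{\widetilde{\mathrm{maj}_{k+1}}(\sigma)}.$$
   Context: $\mathfrak{S}_n$ is the set of permutations of $\{1,\dots,n\}$; $x,y$ are commuting indeterminates. For $k\ge1$ and $\sigma\in\mathfrak{S}_n$: $\mathrm{DES}_k(\sigma)=\{i\in\{1,\dots,n-1\}:\sigma(i)\ge\sigma(i+1)+k\}$; $\mathrm{des}_k(\sigma)=|\mathrm{DES}_k(\sigma)|$; $\mathrm{maj}_k(\sigma)=\sum_{i\in\mathrm{DES}_k(\sigma)}i$; $\widetilde{\mathrm{des}_k}(\sigma)=\mathrm{des}_k(\sigma)$ if $\sigma(1)>n+1-k$, and $\widetilde{\mathrm{des}_k}(\sigma)=\mathrm{des}_k(\sigma)+1$ otherwise; $\widetilde{\mathrm{maj}_k}(\sigma)=\mathrm{maj}_k(\sigma)+\#\{(i,j):i<j\text{ and }\sigma(i)<\sigma(j)<\sigma(i)+k\}$. *)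

theory Defs
  imports "HOL-Combinatorics.Permutations" "HOL-Computational_Algebra.Polynomial"
begin

text \<open>
  The symmetric group of degree \<open>n\<close> is \<open>{\<sigma>. \<sigma> permutes {1..n}}\<close>. Its elements are total
  functions on \<^typ>\<open>nat\<close> fixing everything outside \<open>{1..n}\<close>, so the statistics carry \<open>n\<close> as an
  argument and keep all positions inside \<open>{1..n}\<close>.
\<close>

definition DES :: "nat \<Rightarrow> nat \<Rightarrow> (nat \<Rightarrow> nat) \<Rightarrow> nat set" where
  "DES k n \<sigma> = {i \<in> {1..<n}. \<sigma> i \<ge> \<sigma> (i + 1) + k}"

definition des :: "nat \<Rightarrow> nat \<Rightarrow> (nat \<Rightarrow> nat) \<Rightarrow> nat" where
  "des k n \<sigma> = card (DES k n \<sigma>)"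

definition maj :: "nat \<Rightarrow> nat \<Rightarrow> (nat \<Rightarrow> nat) \<Rightarrow> nat" where
  "maj k n \<sigma> = \<Sum>(DES k n \<sigma>)"

text \<open>The condition \<open>\<sigma>(1) > n + 1 - k\<close> is meant over the integers (\<open>k\<close> may exceed \<open>n + 1\<close>).\<close>

definition des_tilde :: "nat \<Rightarrow> nat \<Rightarrow> (nat \<Rightarrow> nat) \<Rightarrow> nat" where
  "des_tilde k n \<sigma> =
     (if int (\<sigma> 1) > int n + 1 - int k then des k n \<sigma> else des k n \<sigma> + 1)"

definition maj_tilde :: "nat \<Rightarrow> nat \<Rightarrow> (nat \<Rightarrow> nat) \<Rightarrow> nat" where
  "maj_tilde k n \<sigma> = maj k n \<sigma> +
     card {(i, j). i \<in> {1..n} \<and> j \<in> {1..n} \<and> i < j \<and> \<sigma> i < \<sigma> j \<and> \<sigma> j < \<sigma> i + k}"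

text \<open>
  The ring \<open>\<int>[y][x]\<close> of polynomials in two commuting indeterminates is rendered as
  \<^typ>\<open>int poly poly\<close>: \<open>X\<close> is the outer and \<open>Y\<close> the inner indeterminate.
\<close>

definition X :: "int poly poly" where
  "X = [:0, 1:]"

definition Y :: "int poly poly" where
  "Y = [:[:0, 1:]:]"

end

theory Submission
  imports Defs
begin

text \<open>
  Both pairs of statistics satisfy the same recursion under insertion of a new minimum. The
  statistic \<^const>\<open>des_tilde\<close> is the ordinary count of \<open>k\<close>-descents once the word is preceded
  by the letter \<open>n + 1\<close> at position \<open>0\<close>, so the two pairs are treated together.
  Let \<open>1\<close> be inserted after position \<open>j\<close> of \<open>\<pi> \<in> S\<^sub>N\<close>, all other values being raised by one, and
  let \<open>U\<close> be the set of those \<open>j\<close> for which the number \<open>d\<close> of descents does not change. The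
  major index then grows by the number of elements of \<open>U\<close> above \<open>j\<close>, plus \<open>j\<close> if \<open>j \<notin> U\<close>. As \<open>j\<close>
  varies, this increment \<open>c\<close> takes each value \<open>0, \<dots>, N\<close> once, the elements of \<open>U\<close> giving the
  smallest values, and \<open>c < |U|\<close> amounts to \<open>c < d + k\<close> in both cases.
\<close>

section \<open>Increments attached to a set of places\<close>

definition increment :: "nat set \<Rightarrow> nat \<Rightarrow> nat" where
  "increment U j = card {i \<in> U. j < i} + (if j \<in> U then 0 else j)"

lemma increment_mem_less:
  assumes "finite U" "j \<in> U"
  shows "increment U j < card U"
  unfolding increment_def using assms by (auto intro!: psubset_card_mono)

text \<open>The \<open>j\<close> numbers below \<open>j\<close> split into members and non-members
  of \<open>U\<close>. Since \<open>j\<close> itself is missing from \<open>U\<close>, the members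
  below and above \<open>j\<close> make up all of \<open>U\<close>.\<close>

lemma increment_not_mem:
  assumes "finite U" "j \<notin> U"
  shows "increment U j = card U + card {i. i < j \<and> i \<notin> U}"
proof -
  have U: "U = {i \<in> U. j < i} \<union> {i \<in> U. i < j}"
    using assms(2) by (auto simp: not_less_iff_gr_or_eq)
  have "card U = card {i \<in> U. j < i} + card {i \<in> U. i < j}"
    by (subst U, rule card_Un_disjoint) (use assms(1) in auto)
  moreover have "card {..<j} = card {i \<in> U. i < j} + card {i. i < j \<and> i \<notin> U}"
  proof -
    have "{..<j} = {i \<in> U. i < j} \<union> {i. i < j \<and> i \<notin> U}" by auto
    also have "card \<dots> = card {i \<in> U. i < j} + card {i. i < j \<and> i \<notin> U}"
      by (rule card_Un_disjoint) auto
    finally show ?thesis .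
  qed
  ultimately show ?thesis using assms(2) by (simp add: increment_def)
qed

lemma increment_less_iff:
  assumes "finite U"
  shows "increment U j < card U \<longleftrightarrow> j \<in> U"
  using increment_mem_less[OF assms] increment_not_mem[OF assms] by (cases "j \<in> U") auto

text \<open>The increment falls strictly along \<open>U\<close>, with values below
  \<open>card U\<close>, and rises strictly along the complement, with values from
  \<open>card U\<close> on. So it is injective, and an injection of the finite set
  \<open>{..N}\<close> into itself is onto.\<close>

lemma bij_betw_increment:
  assumes "U \<subseteq> {..N}"
  shows "bij_betw (increment U) {..N} {..N}"
proof -
  have fin: "finite U" using assms finite_subset by blast
  have neq: "increment U i \<noteq> increment U j" if "i < j" for i j
  proof (cases "i \<in> U \<longleftrightarrow> j \<in> U")
    case False
    thus ?thesis using increment_less_iff[OF fin] by metis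
  next
    case same: True
    show ?thesis
    proof (cases "i \<in> U")
      case True
      have "{l \<in> U. j < l} \<subset> {l \<in> U. i < l}" using that same True by auto
      hence "card {l \<in> U. j < l} < card {l \<in> U. i < l}" by (intro psubset_card_mono) (use fin in auto)
      thus ?thesis using same True by (simp add: increment_def)
    next
      case False
      have "{l. l < i \<and> l \<notin> U} \<subset> {l. l < j \<and> l \<notin> U}" using that False by auto
      hence "card {l. l < i \<and> l \<notin> U} < card {l. l < j \<and> l \<notin> U}" by (intro psubset_card_mono) auto
      thus ?thesis using same False by (simp add: increment_not_mem fin)
    qed
  qed
  have inj: "inj_on (increment U) {..N}"
    by (rule inj_onI) (metis neq linorder_neqE_nat)
  have "increment U j \<le> N" if "j \<le> N" for j
  proof (cases "j \<in> U")
    case True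
    have "card U \<le> card {..N}" using assms by (intro card_mono) auto
    thus ?thesis using increment_mem_less[OF fin True] by simp
  next
    case False
    \<comment> \<open>Both sets avoid \<open>j\<close>; this makes the bound \<open>N\<close>
      instead of \<open>N + 1\<close>.\<close>
    have "card U + card {i. i < j \<and> i \<notin> U} = card (U \<union> {i. i < j \<and> i \<notin> U})"
      by (rule card_Un_disjoint[symmetric]) (use fin in auto)
    also have "\<dots> \<le> card ({..N} - {j})" using assms False that by (intro card_mono) auto
    finally show ?thesis using increment_not_mem[OF fin False] that by simp
  qed
  hence "increment U ` {..N} \<subseteq> {..N}" by auto
  with inj show ?thesis by (simp add: bij_betw_def endo_inj_surj)
qed

section \<open>Insertion of a new minimum into a permutation\<close>

text \<open>Beyond position \<open>N + 1\<close> the last case returns \<open>i\<close>, because a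
  permutation of \<open>{1..N}\<close> fixes \<open>i - 1\<close>; the case \<open>i = 0\<close>
  keeps 0 fixed. So one formula serves every degree.\<close>

definition insert_min :: "nat \<Rightarrow> (nat \<Rightarrow> nat) \<Rightarrow> nat \<Rightarrow> nat" where
  "insert_min j \<pi> i =
     (if i = 0 then 0 else if i \<le> j then Suc (\<pi> i) else if i = Suc j then 1 else Suc (\<pi> (i - 1)))"

lemma permutes_pos:
  fixes \<pi> :: "nat \<Rightarrow> nat"
  assumes "\<pi> permutes {1..N}" "0 < i"
  shows "0 < \<pi> i"
  using assms by (metis atLeastAtMost_iff gr0I not_one_le_zero permutes_def)

lemma insert_min_permutes:
  assumes \<pi>: "\<pi> permutes {1..N}" and j: "j \<le> N"
  shows "insert_min j \<pi> permutes {1..Suc N}"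
proof (rule inj_imp_permutes)
  have eq: "\<pi> a = \<pi> b \<longleftrightarrow> a = b" for a b using permutes_inj[OF \<pi>] by (auto dest: injD)
  note pos = permutes_pos[OF \<pi>]
  show "inj_on (insert_min j \<pi>) {1..Suc N}"
    by (rule inj_onI) (auto simp: insert_min_def eq pos[THEN less_not_refl2] split: if_splits
        dest!: pos)
  show "insert_min j \<pi> i \<in> {1..Suc N}" if "i \<in> {1..Suc N}" for i
    using that j permutes_in_image[OF \<pi>, of i] permutes_in_image[OF \<pi>, of "i - 1"]
    by (auto simp: insert_min_def)
  show "insert_min j \<pi> i = i" if "i \<notin> {1..Suc N}" for i
  proof (cases "i = 0")
    case False
    hence "\<pi> (i - 1) = i - 1" using that by (intro permutes_not_in[OF \<pi>]) auto
    thus ?thesis using that j by (auto simp: insert_min_def)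
  qed (simp add: insert_min_def)
qed auto

lemma insert_min_eq_1_iff:
  assumes "\<pi> permutes {1..N}" "0 < i"
  shows "insert_min j \<pi> i = 1 \<longleftrightarrow> i = Suc j"
  using assms(2) permutes_pos[OF assms(1), of i] permutes_pos[OF assms(1), of "i - 1"]
  by (auto simp: insert_min_def)

text \<open>The position of the letter 1 gives back \<open>j\<close>, and deleting that letter gives
  back the permutation. Surjectivity follows by counting, as
  \<open>(N + 1) * N! = (N + 1)!\<close>.\<close>

lemma bij_betw_insert_min:
  "bij_betw (\<lambda>(\<pi>, j). insert_min j \<pi>) ({\<pi>. \<pi> permutes {1..N}} \<times> {..N}) {\<sigma>. \<sigma> permutes {1..Suc N}}"
proof -
  let ?f = "\<lambda>(\<pi>, j). insert_min j \<pi>" and ?A = "{\<pi>. \<pi> permutes {1..N}} \<times> {..N}"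
  have inj: "inj_on ?f ?A"
  proof (rule inj_onI, clarsimp)
    fix \<pi> \<rho> j l
    assume \<pi>: "\<pi> permutes {Suc 0..N}" and \<rho>: "\<rho> permutes {Suc 0..N}"
      and eq: "insert_min j \<pi> = insert_min l \<rho>"
    have "j = l"
      using insert_min_eq_1_iff[of \<pi> N "Suc j" j] insert_min_eq_1_iff[of \<rho> N "Suc j" l] \<pi> \<rho> eq
      by simp
    moreover have "\<pi> i = \<rho> i" for i
    proof (cases "i = 0")
      case True
      thus ?thesis using permutes_not_in[OF \<pi>, of 0] permutes_not_in[OF \<rho>, of 0] by simp
    next
      case False
      \<comment> \<open>The value at \<open>i\<close> is read off at \<open>i\<close> if
        \<open>i \<le> j\<close>, and at \<open>Suc i\<close> otherwise.\<close>
      thus ?thesis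
        using fun_cong[OF eq, of i] fun_cong[OF eq, of "Suc i"] \<open>j = l\<close>
        by (auto simp: insert_min_def split: if_splits)
    qed
    ultimately show "\<pi> = \<rho> \<and> j = l" by auto
  qed
  have "card (?f ` ?A) = card ?A" by (rule card_image[OF inj])
  also have "\<dots> = card {\<sigma>. \<sigma> permutes {1..Suc N}}"
    by (simp add: card_cartesian_product card_permutations[OF refl])
  finally have "?f ` ?A = {\<sigma>. \<sigma> permutes {1..Suc N}}"
    by (intro card_subset_eq finite_permutations) (use insert_min_permutes in auto)
  with inj show ?thesis by (simp add: bij_betw_def)
qed

section \<open>Descents and close pairs under insertion\<close>

text \<open>
  The flag \<open>t\<close> decides whether the letter \<open>n + 1\<close> is put at position \<open>0\<close>; otherwise the
  letter \<open>0\<close> stands there, which never starts a descent.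
\<close>

definition descents :: "bool \<Rightarrow> nat \<Rightarrow> nat \<Rightarrow> (nat \<Rightarrow> nat) \<Rightarrow> nat set" where
  "descents t K n \<sigma> =
     {i. i < n \<and> \<sigma> (Suc i) + K \<le> (if i = 0 then if t then Suc n else 0 else \<sigma> i)}"

definition close_pairs :: "nat \<Rightarrow> nat \<Rightarrow> (nat \<Rightarrow> nat) \<Rightarrow> (nat \<times> nat) set" where
  "close_pairs K n \<sigma> =
     {(i, j). i \<in> {1..n} \<and> j \<in> {1..n} \<and> i < j \<and> \<sigma> i < \<sigma> j \<and> \<sigma> j < \<sigma> i + K}"

text \<open>These are the places after which an inserted 1 is the bottom of a descent: it is
  preceded by the raised letter \<open>\<sigma> i + 1\<close>, or at place 0 with the flag set by
  \<open>n + 2\<close>, the top letter of the longer word.\<close>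

definition big_places :: "bool \<Rightarrow> nat \<Rightarrow> nat \<Rightarrow> (nat \<Rightarrow> nat) \<Rightarrow> nat set" where
  "big_places t K n \<sigma> = {i. i \<le> n \<and> (if i = 0 then t \<and> K \<le> Suc n else K \<le> \<sigma> i)}"

lemma finite_descents: "finite (descents t K n \<sigma>)"
  by (rule finite_subset[of _ "{..<n}"]) (auto simp: descents_def)

lemma finite_close_pairs: "finite (close_pairs K n \<sigma>)"
  by (rule finite_subset[of _ "{1..n} \<times> {1..n}"]) (auto simp: close_pairs_def)

lemma descents_subset_big_places:
  assumes "\<pi> permutes {1..N}" "1 \<le> K"
  shows "descents t K N \<pi> \<subseteq> big_places t K N \<pi>"
  using assms(2) permutes_pos[OF assms(1), of "Suc _"]
  by (auto simp: descents_def big_places_def split: if_splits)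

text \<open>Raising all letters keeps the descents before \<open>j\<close> and shifts those after
  \<open>j\<close> by one. The old adjacency at \<open>j\<close> gives way to two: one ends in the
  new 1, the other starts with it and is never a descent.\<close>

lemma descents_insert_min:
  assumes "j \<le> N" and "1 \<le> K"
  shows "descents t K (Suc N) (insert_min j \<pi>) =
    {i \<in> descents t K N \<pi>. i < j} \<union> {i \<in> big_places t K N \<pi>. i = j}
      \<union> Suc ` {i \<in> descents t K N \<pi>. j < i}" (is "?L = ?R")
proof (rule set_eqI)
  fix i
  consider "i < j" | "i = j" | "i = Suc j" | m where "i = Suc m" "j < m"
    by (metis Suc_lessI less_Suc_eq lessE not_less_eq)
  thus "i \<in> ?L \<longleftrightarrow> i \<in> ?R"
    by cases (use assms in \<open>auto simp: descents_def big_places_def insert_min_def image_iff\<close>)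
qed

text \<open>Old pairs survive because differences of values are kept. The new 1 can only be the left
  member of a pair, and its partners are the later letters whose old value is below
  \<open>K\<close>. Place 0 is excluded by \<open>j < i\<close>.\<close>

lemma card_close_pairs_insert_min:
  assumes "\<pi> permutes {1..N}" and j: "j \<le> N"
  shows "card (close_pairs K (Suc N) (insert_min j \<pi>)) =
    card (close_pairs K N \<pi>) + card {i \<in> {..N} - big_places t K N \<pi>. j < i}"
proof -
  \<comment> \<open>\<open>s\<close> sends an old position to its position in the longer word,
    skipping \<open>Suc j\<close>.\<close>
  define s where "s = (\<lambda>i. if i \<le> j then i else Suc i)"
  let ?C = "close_pairs K N \<pi>" and ?V = "{i \<in> {..N} - big_places t K N \<pi>. j < i}"
  have s_less: "s a < s b \<longleftrightarrow> a < b" for a b by (auto simp: s_def)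
  have s_inj: "inj s" by (rule injI) (auto simp: s_def split: if_splits)
  have s_neq: "s a \<noteq> Suc j" for a by (auto simp: s_def)
  have s_val: "insert_min j \<pi> (s a) = Suc (\<pi> a)" if "1 \<le> a" for a
    using that by (auto simp: s_def insert_min_def)
  have new: "insert_min j \<pi> (Suc j) = 1" by (simp add: insert_min_def)
  have s_range: "s a \<in> {1..Suc N} \<longleftrightarrow> a \<in> {1..N}" for a using j by (auto simp: s_def)
  have s_above: "Suc j < s a \<longleftrightarrow> j < a" for a by (auto simp: s_def)
  have cases_s: "a = Suc j \<or> (\<exists>b. a = s b)" for a
  proof (cases "a \<le> Suc j")
    case True
    thus ?thesis unfolding s_def by (metis le_Suc_eq)
  next
    case False
    hence "a = s (a - 1)" by (auto simp: s_def)
    thus ?thesis by blast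
  qed
  have pos: "0 < \<pi> a" if "1 \<le> a" for a using permutes_pos[OF assms(1)] that by simp
  have V: "?V = {b \<in> {1..N}. j < b \<and> \<pi> b < K}" by (auto simp: big_places_def)
  have "close_pairs K (Suc N) (insert_min j \<pi>) =
      map_prod s s ` ?C \<union> (\<lambda>b. (Suc j, s b)) ` ?V" (is "?L = ?R")
  proof (rule set_eqI, clarify)
    fix a b
    consider (old) a' b' where "a = s a'" "b = s b'" | (left) b' where "a = Suc j" "b = s b'"
      | (right) "b = Suc j" using cases_s[of a] cases_s[of b] by blast
    thus "(a, b) \<in> ?L \<longleftrightarrow> (a, b) \<in> ?R"
    proof cases
      case old
      have "(a, b) \<in> ?R \<longleftrightarrow> (a', b') \<in> ?C"
        using old s_neq inj_image_mem_iff[OF prod.inj_map[OF s_inj s_inj], of "(a', b')" ?C]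
        by (auto dest: sym)
      moreover have "(a, b) \<in> ?L \<longleftrightarrow> (a', b') \<in> ?C"
        unfolding close_pairs_def old using s_range[of a'] s_range[of b'] s_val[of a'] s_val[of b']
        by (auto simp: s_less)
      ultimately show ?thesis by simp
    next
      case left
      have "(a, b) \<in> ?R \<longleftrightarrow> b' \<in> ?V"
        using left s_neq by (auto simp: image_iff inj_eq[OF s_inj] dest: sym)
      moreover have "(a, b) \<in> ?L \<longleftrightarrow> b' \<in> ?V"
        unfolding close_pairs_def left V using s_range[of b'] s_val[of b'] pos[of b'] j new
        by (auto simp: s_above)
      ultimately show ?thesis by simp
    next
      case right
      have "(a, b) \<notin> ?R" using right s_neq by (auto dest: sym)
      moreover have "(a, b) \<notin> ?L"
        using right new permutes_pos[OF insert_min_permutes[OF assms(1) j], of a]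
        by (auto simp: close_pairs_def)
      ultimately show ?thesis by simp
    qed
  qed
  moreover have "map_prod s s ` ?C \<inter> (\<lambda>b. (Suc j, s b)) ` ?V = {}"
    using s_neq by (auto dest: sym)
  moreover have "card (map_prod s s ` ?C) = card ?C"
    by (intro card_image) (meson inj_on_subset map_prod_inj_on prod.inj_map s_inj subset_UNIV)
  moreover have "card ((\<lambda>b. (Suc j, s b)) ` ?V) = card ?V"
    by (intro card_image inj_onI) (simp add: inj_eq[OF s_inj])
  ultimately show ?thesis
    by (simp add: card_Un_disjoint finite_close_pairs)
qed

text \<open>A descent at position 0 adds nothing to the sum, so the flag does not affect the
  value.\<close>

definition word_maj :: "bool \<Rightarrow> nat \<Rightarrow> nat \<Rightarrow> (nat \<Rightarrow> nat) \<Rightarrow> nat" where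
  "word_maj t K n \<sigma> = \<Sum>(descents t K n \<sigma>) + card (close_pairs K n \<sigma>)"

text \<open>This is the set \<open>U\<close> of the opening remark. At a place that is not big no
  descent arises; at a place that is already a descent the new one replaces the old.\<close>

definition stable_places :: "bool \<Rightarrow> nat \<Rightarrow> nat \<Rightarrow> (nat \<Rightarrow> nat) \<Rightarrow> nat set" where
  "stable_places t K n \<sigma> = {..n} - (big_places t K n \<sigma> - descents t K n \<sigma>)"

lemma statistics_insert_min:
  assumes "\<pi> permutes {1..N}" and j: "j \<le> N" and "1 \<le> K"
  shows "card (descents t K (Suc N) (insert_min j \<pi>)) =
      card (descents t K N \<pi>) + (if j \<in> stable_places t K N \<pi> then 0 else 1)" (is ?des)
    and "word_maj t K (Suc N) (insert_min j \<pi>) =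
      word_maj t K N \<pi> + increment (stable_places t K N \<pi>) j" (is ?maj)
proof -
  let ?D = "descents t K N \<pi>" and ?B = "big_places t K N \<pi>" and ?U = "stable_places t K N \<pi>"
  let ?lo = "{i \<in> ?D. i < j}" and ?mid = "{i \<in> ?B. i = j}" and ?hi = "{i \<in> ?D. j < i}"
  let ?Dmid = "{i \<in> ?D. i = j}" and ?V = "{i \<in> {..N} - ?B. j < i}"
  have DB: "?D \<subseteq> ?B" by (rule descents_subset_big_places[OF assms(1,3)])
  have DN: "?D \<subseteq> {..N}" by (auto simp: descents_def)
  have fin: "finite ?lo" "finite ?hi" "finite ?Dmid" "finite (?lo \<union> ?Dmid)"
    using finite_descents[of t K N \<pi>] by auto
  have fmid: "finite ?mid" by (rule finite_subset[of _ "{j}"]) auto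
  have D: "?D = (?lo \<union> ?Dmid) \<union> ?hi" by auto
  have ins: "descents t K (Suc N) (insert_min j \<pi>) = (?lo \<union> ?mid) \<union> Suc ` ?hi"
    by (rule descents_insert_min[OF assms(2,3)])
  have disj: "?lo \<inter> ?mid = {}" "(?lo \<union> ?mid) \<inter> Suc ` ?hi = {}"
    "?lo \<inter> ?Dmid = {}" "(?lo \<union> ?Dmid) \<inter> ?hi = {}" by auto
  have mid: "?mid = (if j \<in> ?B then {j} else {})" "?Dmid = (if j \<in> ?D then {j} else {})" by auto
  have cD: "card ?D = card ?lo + card ?Dmid + card ?hi"
    by (subst D) (simp only: card_Un_disjoint fin disj finite_UnI)
  have sD: "\<Sum>?D = \<Sum>?lo + \<Sum>?Dmid + \<Sum>?hi"
    by (subst D) (simp only: sum.union_disjoint fin disj finite_UnI)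
  have "card (descents t K (Suc N) (insert_min j \<pi>)) = card ?lo + card ?mid + card ?hi"
    unfolding ins by (subst card_Un_disjoint; (subst card_Un_disjoint)?)
      (use fin fmid disj in \<open>simp_all add: card_image\<close>)
  thus ?des using DB j by (auto simp: cD mid stable_places_def)
  have "\<Sum>(descents t K (Suc N) (insert_min j \<pi>)) = \<Sum>?lo + \<Sum>?mid + \<Sum>(Suc ` ?hi)"
    unfolding ins by (subst sum.union_disjoint; (subst sum.union_disjoint)?)
      (use fin fmid disj in simp_all)
  also have "\<Sum>(Suc ` ?hi) = \<Sum>?hi + card ?hi"
    using sum_Suc[of "\<lambda>i. i" ?hi] by (simp add: sum.reindex)
  finally have s: "\<Sum>(descents t K (Suc N) (insert_min j \<pi>)) =
      \<Sum>?lo + \<Sum>?mid + (\<Sum>?hi + card ?hi)" .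
  \<comment> \<open>Stable places after \<open>j\<close> are of two kinds: descents, each moved one
    step right and so adding 1 to the sum of positions, and places that are not big, each adding one
    close pair.\<close>
  have "{i \<in> ?U. j < i} = ?hi \<union> ?V" using DN DB by (auto simp: stable_places_def)
  moreover have "?hi \<inter> ?V = {}" using DB by auto
  ultimately have "card {i \<in> ?U. j < i} = card ?hi + card ?V"
    using fin by (simp add: card_Un_disjoint)
  thus ?maj
    using DB j s sD card_close_pairs_insert_min[OF assms(1,2), where K = K and t = t]
    by (auto simp: word_maj_def increment_def mid stable_places_def)
qed

section \<open>The number of stable places\<close>

text \<open>The letters below \<open>K\<close> account for \<open>min N (K - 1)\<close> places.
  Place 0 joins them if the flag is off or \<open>K\<close> exceeds \<open>N + 1\<close>. This extra
  place is why \<open>k\<close> without the flag matches \<open>k + 1\<close> with it.\<close>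

lemma card_small_places:
  assumes \<pi>: "\<pi> permutes {1..N}" and "1 \<le> K"
  shows "card ({..N} - big_places t K N \<pi>) = min (if t then K - 1 else K) (Suc N)"
proof -
  let ?S = "{i \<in> {1..N}. \<pi> i < K}"
  have "\<pi> ` ?S = {v \<in> \<pi> ` {1..N}. v < K}" by auto
  also have "\<dots> = {1..min N (K - 1)}" unfolding permutes_image[OF \<pi>] using assms(2) by auto
  finally have "\<pi> ` ?S = {1..min N (K - 1)}" .
  hence S: "card ?S = min N (K - 1)"
    using card_image[of \<pi> ?S] permutes_inj_on[OF \<pi>] by simp
  have "{..N} - big_places t K N \<pi> = (if t \<and> K \<le> Suc N then {} else {0}) \<union> ?S"
    by (auto simp: big_places_def)
  also have "card \<dots> = (if t \<and> K \<le> Suc N then 0 else 1) + card ?S" by simp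
  finally show ?thesis using assms(2) S by auto
qed

lemma card_stable_places:
  assumes "\<pi> permutes {1..N}" "1 \<le> K"
  shows "card (stable_places t K N \<pi>) =
    min (if t then K - 1 else K) (Suc N) + card (descents t K N \<pi>)"
proof -
  have "descents t K N \<pi> \<subseteq> {..N}" by (auto simp: descents_def)
  hence "stable_places t K N \<pi> = ({..N} - big_places t K N \<pi>) \<union> descents t K N \<pi>"
    by (auto simp: stable_places_def)
  moreover have "({..N} - big_places t K N \<pi>) \<inter> descents t K N \<pi> = {}"
    using descents_subset_big_places[OF assms] by auto
  ultimately show ?thesis
    by (simp add: card_Un_disjoint finite_descents card_small_places[OF assms])
qed

section \<open>The common recursion\<close>

text \<open>Reindexing the insertion place by its increment \<open>c\<close> leaves a summand that
  depends on the permutation only through its two statistics, and on the flag and \<open>K\<close>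
  only through \<open>k\<close>.\<close>

lemma sum_statistics_Suc:
  fixes f :: "nat \<Rightarrow> nat \<Rightarrow> 'a :: comm_monoid_add"
  assumes K: "1 \<le> K" and k: "k = (if t then K - 1 else K)"
  shows "(\<Sum>\<sigma> | \<sigma> permutes {1..Suc N}. f (card (descents t K (Suc N) \<sigma>)) (word_maj t K (Suc N) \<sigma>)) =
    (\<Sum>\<pi> | \<pi> permutes {1..N}. \<Sum>c\<le>N.
       f (card (descents t K N \<pi>) + (if c < card (descents t K N \<pi>) + k then 0 else 1))
         (word_maj t K N \<pi> + c))" (is "?lhs = (\<Sum>\<pi> | _. \<Sum>c\<le>N. ?g \<pi> c)")
proof -
  have "?lhs = (\<Sum>(\<pi>, j) \<in> {\<pi>. \<pi> permutes {1..N}} \<times> {..N}.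
      f (card (descents t K (Suc N) (insert_min j \<pi>))) (word_maj t K (Suc N) (insert_min j \<pi>)))"
    by (subst sum.reindex_bij_betw[OF bij_betw_insert_min, symmetric])
      (simp add: case_prod_beta)
  also have "\<dots> = (\<Sum>\<pi> | \<pi> permutes {1..N}. \<Sum>j\<le>N.
      f (card (descents t K (Suc N) (insert_min j \<pi>))) (word_maj t K (Suc N) (insert_min j \<pi>)))"
    by (rule sum.cartesian_product[symmetric])
  also have "\<dots> = (\<Sum>\<pi> | \<pi> permutes {1..N}. \<Sum>c\<le>N. ?g \<pi> c)"
  proof (rule sum.cong[OF refl])
    fix \<pi> assume "\<pi> \<in> {\<pi>. \<pi> permutes {1..N}}"
    hence \<pi>: "\<pi> permutes {1..N}" by simp
    let ?U = "stable_places t K N \<pi>"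
    have U: "?U \<subseteq> {..N}" by (auto simp: stable_places_def)
    have bij: "bij_betw (increment ?U) {..N} {..N}" by (rule bij_betw_increment[OF U])
    have "f (card (descents t K (Suc N) (insert_min j \<pi>))) (word_maj t K (Suc N) (insert_min j \<pi>)) =
        ?g \<pi> (increment ?U j)" if "j \<le> N" for j
    proof -
      have "increment ?U j \<le> N" using bij that by (auto simp: bij_betw_def)
      moreover have "j \<in> ?U \<longleftrightarrow> increment ?U j < card ?U"
        using increment_less_iff[of ?U j] U finite_subset by blast
      \<comment> \<open>The cap \<open>Suc N\<close> in the cardinality has no effect, since
        increments are at most \<open>N\<close>.\<close>
      ultimately have "j \<in> ?U \<longleftrightarrow> increment ?U j < card (descents t K N \<pi>) + k"
        unfolding card_stable_places[OF \<pi> K] k by auto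
      thus ?thesis by (simp add: statistics_insert_min[OF \<pi> that K])
    qed
    hence "(\<Sum>j\<le>N. f (card (descents t K (Suc N) (insert_min j \<pi>)))
        (word_maj t K (Suc N) (insert_min j \<pi>))) = (\<Sum>j\<le>N. ?g \<pi> (increment ?U j))"
      by (intro sum.cong) auto
    also have "\<dots> = (\<Sum>c\<le>N. ?g \<pi> c)" by (rule sum.reindex_bij_betw[OF bij])
    finally show "(\<Sum>j\<le>N. f (card (descents t K (Suc N) (insert_min j \<pi>)))
        (word_maj t K (Suc N) (insert_min j \<pi>))) = (\<Sum>c\<le>N. ?g \<pi> c)" .
  qed
  finally show ?thesis .
qed

lemma sum_statistics_eq:
  fixes f :: "nat \<Rightarrow> nat \<Rightarrow> 'a :: comm_monoid_add"
  assumes "1 \<le> k"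
  shows "(\<Sum>\<sigma> | \<sigma> permutes {1..n}. f (card (descents False k n \<sigma>)) (word_maj False k n \<sigma>)) =
    (\<Sum>\<sigma> | \<sigma> permutes {1..n}. f (card (descents True (k + 1) n \<sigma>)) (word_maj True (k + 1) n \<sigma>))"
proof (induction n arbitrary: f)
  case 0
  show ?case by (simp add: descents_def word_maj_def close_pairs_def)
next
  case (Suc n)
  have k: "k = (if True then k + 1 - 1 else k + 1)" "k = (if False then k - 1 else k)"
    "1 \<le> k + 1" by simp_all
  show ?case
    unfolding sum_statistics_Suc[OF assms k(2)] sum_statistics_Suc[OF k(3,1)]
    \<comment> \<open>The inner sum over \<open>c\<close> is itself a function of the two
      statistics, so the induction is over all \<open>f\<close>.\<close>
    by (rule Suc.IH[of "\<lambda>d m. \<Sum>c\<le>n. f (d + (if c < d + k then 0 else 1)) (m + c)"])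
qed

section \<open>Return to the original statistics\<close>

text \<open>The inequality on \<open>\<sigma> 1\<close> is the negation of the test in
  \<open>des_tilde\<close>, so position 0 is a descent exactly when \<open>des_tilde\<close> adds
  one.\<close>

lemma descents_eq_DES:
  assumes "1 \<le> K" "1 \<le> n"
  shows "descents t K n \<sigma> = DES K n \<sigma> \<union> (if t \<and> \<sigma> 1 + K \<le> n + 1 then {0} else {})"
  using assms by (auto simp: descents_def DES_def)

lemma descents_statistics:
  assumes "1 \<le> K" "1 \<le> n"
  shows "card (descents False K n \<sigma>) = des K n \<sigma>"
    and "card (descents True K n \<sigma>) = des_tilde K n \<sigma>"
    and "word_maj t K n \<sigma> = maj_tilde K n \<sigma>"
proof -
  have DES: "finite (DES K n \<sigma>)" "0 \<notin> DES K n \<sigma>" by (auto simp: DES_def)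
  note eq = descents_eq_DES[OF assms]
  show "card (descents False K n \<sigma>) = des K n \<sigma>" by (simp add: eq des_def)
  show "card (descents True K n \<sigma>) = des_tilde K n \<sigma>"
    using DES by (auto simp: eq des_def des_tilde_def)
  have "\<Sum>(descents t K n \<sigma>) = maj K n \<sigma>" using DES by (simp add: eq maj_def)
  thus "word_maj t K n \<sigma> = maj_tilde K n \<sigma>"
    by (simp add: word_maj_def maj_tilde_def close_pairs_def)
qed

lemma sum_des_maj_tilde_eq:
  fixes f :: "nat \<Rightarrow> nat \<Rightarrow> 'a :: comm_monoid_add"
  assumes "1 \<le> n" "1 \<le> k"
  shows "(\<Sum>\<sigma> | \<sigma> permutes {1..n}. f (des k n \<sigma>) (maj_tilde k n \<sigma>)) =
    (\<Sum>\<sigma> | \<sigma> permutes {1..n}. f (des_tilde (k + 1) n \<sigma>) (maj_tilde (k + 1) n \<sigma>))"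
  using sum_statistics_eq[OF assms(2), of f n] assms by (simp add: descents_statistics)

theorem corollary3p2:
  fixes n k :: nat
  assumes "n \<ge> 1" and "k \<ge> 1"
  shows "(\<forall>a b. card {\<sigma>. \<sigma> permutes {1..n} \<and> des k n \<sigma> = a \<and> maj_tilde k n \<sigma> = b} =
                card {\<sigma>. \<sigma> permutes {1..n} \<and> des_tilde (k + 1) n \<sigma> = a \<and> maj_tilde (k + 1) n \<sigma> = b})
       \<and> (\<Sum>\<sigma> | \<sigma> permutes {1..n}. X ^ des k n \<sigma> * Y ^ maj_tilde k n \<sigma>) =
         (\<Sum>\<sigma> | \<sigma> permutes {1..n}. X ^ des_tilde (k + 1) n \<sigma> * Y ^ maj_tilde (k + 1) n \<sigma>)"
proof (intro conjI allI)
  fix a b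
  \<comment> \<open>Writing the count as a sum of indicators makes it an instance of the identity
    for arbitrary \<open>f\<close>, just as the monomials are below.\<close>
  have count: "card {\<sigma>. \<sigma> permutes {1..n} \<and> d \<sigma> = a \<and> m \<sigma> = b} =
      (\<Sum>\<sigma> | \<sigma> permutes {1..n}. if d \<sigma> = a \<and> m \<sigma> = b then 1 else 0)" for d m :: "(nat \<Rightarrow> nat) \<Rightarrow> nat"
    by (simp add: sum.If_cases finite_permutations Collect_conj_eq)
  show "card {\<sigma>. \<sigma> permutes {1..n} \<and> des k n \<sigma> = a \<and> maj_tilde k n \<sigma> = b} =
      card {\<sigma>. \<sigma> permutes {1..n} \<and> des_tilde (k + 1) n \<sigma> = a \<and> maj_tilde (k + 1) n \<sigma> = b}"
    unfolding count by (rule sum_des_maj_tilde_eq[OF assms, of "\<lambda>d m. if d = a \<and> m = b then 1 else 0"])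
next
  show "(\<Sum>\<sigma> | \<sigma> permutes {1..n}. X ^ des k n \<sigma> * Y ^ maj_tilde k n \<sigma>) =
      (\<Sum>\<sigma> | \<sigma> permutes {1..n}. X ^ des_tilde (k + 1) n \<sigma> * Y ^ maj_tilde (k + 1) n \<sigma>)"
    by (rule sum_des_maj_tilde_eq[OF assms])
qed

end
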